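(* Let $1\leq q<\infty$ and let $\lambda,\alpha,\beta,\psi$ be real numbers with $\alpha+1\geq 0$. Then the operator $\mathbf{H}_{\lambda,\alpha,\beta}$ is bounded from $l^{\infty}$ to $L_{\psi}^{q}$ if and only if both $$\lambda>\alpha+\beta+1+\frac{\psi+1}{q}\qquad\text{and}\qquad -q\beta<\psi+1$$ hold.
   Context: Let $\mathbb{R}_{+}=(0,+\infty)$ and $\mathbb{N}=\{1,2,3,\dots\}$. For real $\lambda,\alpha,\beta$ and a real sequence $a=\{a_m\}_{m=1}^{\infty}$, define $$\mathbf{H}_{\lambda,\alpha,\beta}a(x):=\sum_{m=1}^{\infty}\frac{m^{\alpha}x^{\beta}}{[\max\{m,x\}]^{\lambda}}a_m,\quad x\in\mathbb{R}_{+}.$$ $l^\infty$ is the space of real sequences with $\|a\|_\infty=\sup_{n\in\mathbb{N}}|a_n|<\infty$. For $1\le q<\infty$ and $\theta\in\mathbb{R}$, $L_\theta^q$ is the space of real-valued measurable functions $f$ on $\mathbb{R}_{+}$ with $\|f\|_{q,\theta}=(\int_{\mathbb{R}_{+}}|f(x)|^q x^\theta\,dx)^{1/q}<\infty$. The operator is bounded from a sequence space $X$ to a function space $Y$ if for every $a\in X$ the defining series converges for a.e. $x\in\mathbb{R}_{+}$ and there is a constant $C$ with $\|\mathbf{H}_{\lambda,\alpha,\beta}a\|_Y\le C\|a\|_X$ for all $a\in X$. *)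

theory Defs
  imports "HOL-Analysis.Analysis"
begin

text \<open>
  A sequence indexed by the positive integers is a function on \<^typ>\<open>nat\<close> whose value at 0 is
  never used: suprema range over the indices from 1 on, and the series is summed over \<open>m = Suc n\<close>.
\<close>

definition l_inf :: "(nat \<Rightarrow> real) set" where
  "l_inf = {a. bdd_above ((\<lambda>n. \<bar>a n\<bar>) ` {1..})}"

definition l_inf_norm :: "(nat \<Rightarrow> real) \<Rightarrow> real" where
  "l_inf_norm a = (SUP n\<in>{1..}. \<bar>a n\<bar>)"

text \<open>
  Measurable means Lebesgue measurable. The integrability requirement says that the (nonnegative)
  integral defining the norm is finite, so that the Bochner integral in the norm below is the
  actual integral on the space. Functions are not identified when they agree almost everywhere,
  which affects neither membership nor the norm.
\<close>

definition weighted_L :: "real \<Rightarrow> real \<Rightarrow> (real \<Rightarrow> real) set" where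
  "weighted_L q \<theta> =
     {f. f \<in> borel_measurable (lebesgue_on {0<..}) \<and>
         integrable (lebesgue_on {0<..}) (\<lambda>x. \<bar>f x\<bar> powr q * x powr \<theta>)}"

definition weighted_L_norm :: "real \<Rightarrow> real \<Rightarrow> (real \<Rightarrow> real) \<Rightarrow> real" where
  "weighted_L_norm q \<theta> f =
     (integral\<^sup>L (lebesgue_on {0<..}) (\<lambda>x. \<bar>f x\<bar> powr q * x powr \<theta>)) powr (1 / q)"

definition H_term :: "real \<Rightarrow> real \<Rightarrow> real \<Rightarrow> (nat \<Rightarrow> real) \<Rightarrow> real \<Rightarrow> nat \<Rightarrow> real" where
  "H_term lam \<alpha> \<beta> a x m = (real m powr \<alpha> * x powr \<beta>) / (max (real m) x powr lam) * a m"

definition H_op :: "real \<Rightarrow> real \<Rightarrow> real \<Rightarrow> (nat \<Rightarrow> real) \<Rightarrow> real \<Rightarrow> real" where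
  "H_op lam \<alpha> \<beta> a x = (\<Sum>n. H_term lam \<alpha> \<beta> a x (Suc n))"

text \<open>
  The spaces are given by their carrier sets and norms. The norm on \<open>Y\<close> is real-valued and
  meaningful on \<open>Y\<close> only, so the finiteness implicit in the norm inequality is the explicit
  requirement that the image lies in \<open>Y\<close>.
\<close>

definition H_bounded ::
  "real \<Rightarrow> real \<Rightarrow> real \<Rightarrow> (nat \<Rightarrow> real) set \<Rightarrow> ((nat \<Rightarrow> real) \<Rightarrow> real) \<Rightarrow>
   (real \<Rightarrow> real) set \<Rightarrow> ((real \<Rightarrow> real) \<Rightarrow> real) \<Rightarrow> bool" where
  "H_bounded lam \<alpha> \<beta> X normX Y normY \<longleftrightarrow>
     (\<forall>a\<in>X. AE x in lebesgue_on {0<..}. summable (\<lambda>n. H_term lam \<alpha> \<beta> a x (Suc n))) \<and>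
     (\<exists>C. \<forall>a\<in>X. H_op lam \<alpha> \<beta> a \<in> Y \<and> normY (H_op lam \<alpha> \<beta> a) \<le> C * normX a)"

end

theory Submission
  imports Defs
begin

text \<open>
  Both directions compare the operator with one family of model functions,
  \<open>x\<^sup>\<beta> max(1, x)\<^sup>s\<close>. Such a function is a pure power on each side of \<open>x = 1\<close>, so that
  its membership in the weighted space amounts to one condition on the exponent at \<open>0\<close> and one on
  the exponent at infinity (\<open>two_regime_power_in_weighted_L_iff\<close>).

  Necessity. The constant sequence \<open>1\<close> lies in the domain. Put \<open>y = max(1, x)\<close>. The series for this
  sequence has at least \<open>y\<close> terms whose index is between \<open>y\<close> and \<open>4 y\<close>, and each of
  them is comparable to \<open>y\<^bsup>\<alpha>-\<lambda>\<^esup> x\<^sup>\<beta>\<close>, so the image is at least a constant times the model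
  function with \<open>s = \<alpha> + 1 - \<lambda>\<close> (\<open>H_op_one_lower_bound\<close>). This model function is therefore in the
  target space, and its two conditions are the two inequalities of the criterion.

  Sufficiency. The sum of \<open>m\<^sup>\<alpha>\<close> over \<open>m \<le> x\<close> grows like a logarithm when \<open>\<alpha> = -1\<close>, so the
  matching upper bound with \<open>s = \<alpha> + 1 - \<lambda>\<close> fails there. Since the first inequality of the
  criterion is strict, an \<open>\<epsilon> > 0\<close> of room is available: taking the factor \<open>m\<^bsup>-1-\<epsilon>\<^esup>\<close> out of each
  term leaves a convergent series in \<open>m\<close> and a remainder that is at most the model function with
  \<open>s = \<alpha> + 1 + \<epsilon> - \<lambda>\<close>, uniformly in \<open>m\<close> (\<open>abs_H_term_le\<close>). Summing gives a pointwise bound by a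
  multiple of \<open>\<parallel>a\<parallel>\<^sub>\<infinity>\<close> times that model function, which is in the target space when \<open>\<epsilon>\<close> is small.
\<close>

section \<open>Power integrals near zero and near infinity\<close>

text \<open>
  The integral of \<open>1/x\<close> over \<open>{a..b}\<close> is \<open>ln b - ln a\<close>. Hence an integrable function above \<open>1/x\<close>
  confines its domain: the intervals inside it have bounded logarithmic length. The lemma serves
  both ends of the half-line, with \<open>a \<rightarrow> 0\<close> or with \<open>b \<rightarrow> \<infinity>\<close>.
\<close>

lemma not_integrable_ge_inverse:
  fixes f :: "real \<Rightarrow> real"
  assumes f: "f integrable_on S"
    and ge: "\<And>x. x \<in> S \<Longrightarrow> inverse x \<le> f x"
    and pos: "S \<subseteq> {0<..}"
    and long: "\<And>t. 0 < t \<Longrightarrow> \<exists>a b. 0 < a \<and> a \<le> b \<and> {a..b} \<subseteq> S \<and> t \<le> ln b - ln a"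
  shows False
proof -
  have f_nonneg: "0 \<le> f x" if "x \<in> S" for x
    using ge[OF that] pos that by (smt (verit) greaterThan_iff positive_imp_inverse_positive subsetD)
  have "0 < \<bar>integral S f\<bar> + 1"
    by simp
  from long[OF this] obtain a b
    where ab: "0 < a" "a \<le> b" "{a..b} \<subseteq> S" "\<bar>integral S f\<bar> + 1 \<le> ln b - ln a"
    by blast
  have inv: "(inverse has_integral (ln b - ln a)) {a..b}"
  proof (rule fundamental_theorem_of_calculus[OF ab(2)])
    fix x assume "x \<in> {a..b}"
    then have "(ln has_real_derivative inverse x) (at x within {a..b})"
      using ab(1) by (auto intro!: derivative_eq_intros simp: inverse_eq_divide)
    then show "(ln has_vector_derivative inverse x) (at x within {a..b})"
      by (simp add: has_real_derivative_iff_has_vector_derivative)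
  qed
  have f_on_ab: "f integrable_on {a..b}"
    using integrable_on_subinterval[OF f ab(3)] .
  have "ln b - ln a = integral {a..b} inverse"
    using inv by (simp add: integral_unique)
  also have "\<dots> \<le> integral {a..b} f"
    using inv f_on_ab ge ab(3) by (intro integral_le) auto
  also have "\<dots> \<le> integral S f"
    using f_on_ab f f_nonneg ab(3) by (intro integral_subset_le) auto
  finally show False
    using ab(4) by linarith
qed

lemma powr_absolutely_integrable_near_0_iff:
  fixes p :: real
  shows "(\<lambda>x. x powr p) absolutely_integrable_on {0<..1} \<longleftrightarrow> -1 < p"
proof
  assume "-1 < p"
  then show "(\<lambda>x. x powr p) absolutely_integrable_on {0<..1}"
    by (intro nonnegative_absolutely_integrable_1 integrable_on_powr_from_0') auto
next
  assume int: "(\<lambda>x. x powr p) absolutely_integrable_on {0<..1}"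
  show "-1 < p"
  proof (rule ccontr)
    assume p: "\<not> -1 < p"
    show False
    proof (rule not_integrable_ge_inverse)
      show "(\<lambda>x. x powr p) integrable_on {0<..1}"
        using int by (simp add: absolutely_integrable_on_def)
      fix x :: real assume "x \<in> {0<..1}"
      then show "inverse x \<le> x powr p"
        using p powr_mono'[of p "-1" x] by (simp add: powr_minus)
    next
      fix t :: real assume "0 < t"
      then show "\<exists>a b. 0 < a \<and> a \<le> b \<and> {a..b} \<subseteq> {0<..1} \<and> t \<le> ln b - ln a"
        by (intro exI[of _ "exp (- t)"] exI[of _ 1]) (auto intro: less_le_trans[OF exp_gt_zero])
    qed auto
  qed
qed

lemma powr_absolutely_integrable_near_infinity_iff:
  fixes p :: real
  shows "(\<lambda>x. x powr p) absolutely_integrable_on {1..} \<longleftrightarrow> p < -1"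
proof
  assume "p < -1"
  then have "(\<lambda>x. x powr p) integrable_on {1..}"
    using has_integral_powr_to_inf[of p 1] by (auto simp: integrable_on_def)
  then show "(\<lambda>x. x powr p) absolutely_integrable_on {1..}"
    by (intro nonnegative_absolutely_integrable_1) auto
next
  assume int: "(\<lambda>x. x powr p) absolutely_integrable_on {1..}"
  show "p < -1"
  proof (rule ccontr)
    assume p: "\<not> p < -1"
    show False
    proof (rule not_integrable_ge_inverse)
      show "(\<lambda>x. x powr p) integrable_on {1..}"
        using int by (simp add: absolutely_integrable_on_def)
      fix x :: real assume "x \<in> {1..}"
      then show "inverse x \<le> x powr p"
        using p powr_mono[of "-1" p x] by (simp add: powr_minus)
    next
      fix t :: real assume "0 < t"
      then show "\<exists>a b. 0 < a \<and> a \<le> b \<and> {a..b} \<subseteq> {1..} \<and> t \<le> ln b - ln a"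
        by (intro exI[of _ 1] exI[of _ "exp t"]) auto
    qed auto
  qed
qed

section \<open>Weighted Lebesgue spaces and two-regime power functions\<close>

text \<open>
  The weighted space is solid. The domination is required only almost everywhere because the lower
  bound for the operator is available only at the points where the series converges.
\<close>

lemma weighted_L_dominated:
  assumes q: "0 < q" and K: "0 \<le> K"
    and f: "f \<in> borel_measurable (lebesgue_on {0<..})"
    and g: "g \<in> weighted_L q \<theta>"
    and le: "AE x in lebesgue_on {0<..}. \<bar>f x\<bar> \<le> K * \<bar>g x\<bar>"
  shows "f \<in> weighted_L q \<theta>" and "weighted_L_norm q \<theta> f \<le> K * weighted_L_norm q \<theta> g"
proof -
  let ?M = "lebesgue_on {0<..} :: real measure"
  let ?F = "\<lambda>x. \<bar>f x\<bar> powr q * x powr \<theta>" and ?G = "\<lambda>x. \<bar>g x\<bar> powr q * x powr \<theta>"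
  have [measurable]: "f \<in> borel_measurable ?M" by (rule f)
  have [measurable]: "(\<lambda>x. x) \<in> borel_measurable ?M"
    by (intro measurable_restrict_space1 measurable_completion) simp
  have G: "integrable ?M ?G"
    using g by (simp add: weighted_L_def)
  then have KG: "integrable ?M (\<lambda>x. K powr q * ?G x)"
    by simp
  have FG: "AE x in ?M. ?F x \<le> K powr q * ?G x"
    using le
  proof eventually_elim
    case (elim x)
    then have "\<bar>f x\<bar> powr q \<le> (K * \<bar>g x\<bar>) powr q"
      using q by (intro powr_mono2) auto
    also have "\<dots> = K powr q * \<bar>g x\<bar> powr q"
      using K by (simp add: powr_mult)
    finally show ?case
      by (simp add: mult_right_mono flip: mult.assoc)
  qed
  have F: "integrable ?M ?F"
  proof (rule Bochner_Integration.integrable_bound[OF KG])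
    show "?F \<in> borel_measurable ?M" by measurable
    show "AE x in ?M. norm (?F x) \<le> norm (K powr q * ?G x)"
      using FG by eventually_elim simp
  qed
  then show "f \<in> weighted_L q \<theta>"
    using f by (simp add: weighted_L_def)
  have "integral\<^sup>L ?M ?F \<le> K powr q * integral\<^sup>L ?M ?G"
    using integral_mono_AE[OF F KG FG] by simp
  then have "weighted_L_norm q \<theta> f \<le> (K powr q * integral\<^sup>L ?M ?G) powr (1 / q)"
    unfolding weighted_L_norm_def using q by (intro powr_mono2) (auto intro: integral_nonneg_AE)
  also have "\<dots> = K * weighted_L_norm q \<theta> g"
    unfolding weighted_L_norm_def using q K
    by (simp add: powr_mult powr_powr integral_nonneg_AE)
  finally show "weighted_L_norm q \<theta> f \<le> K * weighted_L_norm q \<theta> g" .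
qed

text \<open>
  The factor \<open>x\<^sup>\<beta>\<close> is exactly the factor of the operator that does not depend on \<open>m\<close>; the other
  factor, equal to \<open>1\<close> for \<open>x \<le> 1\<close>, changes the growth at infinity to \<open>x\<^bsup>\<beta>+s\<^esup>\<close>.
\<close>

definition two_regime_power :: "real \<Rightarrow> real \<Rightarrow> real \<Rightarrow> real" where
  "two_regime_power \<beta> s x = x powr \<beta> * max 1 x powr s"

lemma two_regime_power_nonneg: "0 \<le> two_regime_power \<beta> s x"
  by (simp add: two_regime_power_def)

lemma two_regime_power_measurable:
  "two_regime_power \<beta> s \<in> borel_measurable (lebesgue_on {0<..})"
  unfolding two_regime_power_def[abs_def]
  by (intro measurable_restrict_space1 measurable_completion) measurable

lemma two_regime_power_in_weighted_L_iff:
  "two_regime_power \<beta> s \<in> weighted_L q \<theta> \<longleftrightarrow> -1 < q * \<beta> + \<theta> \<and> q * (\<beta> + s) + \<theta> < -1"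
proof -
  let ?F = "\<lambda>x. \<bar>two_regime_power \<beta> s x\<bar> powr q * x powr \<theta>"
  have "?F x = x powr (q * \<beta> + \<theta>)" if "x \<in> {0<..1}" for x
  proof -
    have "max 1 x = 1"
      using that by simp
    then show ?thesis
      by (simp add: two_regime_power_def powr_add powr_powr mult.commute)
  qed
  then have near_0: "?F absolutely_integrable_on {0<..1} \<longleftrightarrow> -1 < q * \<beta> + \<theta>"
    unfolding powr_absolutely_integrable_near_0_iff[symmetric]
    by (intro set_integrable_cong refl) auto
  have "?F x = x powr (q * (\<beta> + s) + \<theta>)" if "x \<in> {1..}" for x
  proof -
    have "two_regime_power \<beta> s x = x powr (\<beta> + s)"
      using that by (simp add: two_regime_power_def powr_add max_def)
    then have "\<bar>two_regime_power \<beta> s x\<bar> powr q = x powr (q * (\<beta> + s))"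
      by (simp add: powr_powr mult.commute)
    then show ?thesis
      by (simp only: powr_add[of x "q * (\<beta> + s)" \<theta>])
  qed
  then have near_inf: "?F absolutely_integrable_on {1..} \<longleftrightarrow> q * (\<beta> + s) + \<theta> < -1"
    unfolding powr_absolutely_integrable_near_infinity_iff[symmetric]
    by (intro set_integrable_cong refl) auto
  have split: "{0<..1} \<union> {1..} = {0::real<..}"
    by auto
  have "two_regime_power \<beta> s \<in> weighted_L q \<theta> \<longleftrightarrow> ?F absolutely_integrable_on {0<..}"
    by (simp add: weighted_L_def two_regime_power_measurable integrable_restrict_space
        set_integrable_def)
  also have "\<dots> \<longleftrightarrow> ?F absolutely_integrable_on {0<..1} \<and> ?F absolutely_integrable_on {1..}"
  proof safe
    assume "?F absolutely_integrable_on {0<..}"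
    then show "?F absolutely_integrable_on {0<..1}" "?F absolutely_integrable_on {1..}"
      by (rule set_integrable_subset; auto)+
  next
    assume "?F absolutely_integrable_on {0<..1}" "?F absolutely_integrable_on {1..}"
    then have "?F absolutely_integrable_on ({0<..1} \<union> {1..})"
      by (rule set_integrable_Un) auto
    then show "?F absolutely_integrable_on {0<..}"
      unfolding split .
  qed
  finally show ?thesis
    using near_0 near_inf by simp
qed

section \<open>Pointwise bounds for the operator\<close>

lemma abs_le_l_inf_norm:
  assumes "a \<in> l_inf" "1 \<le> n"
  shows "\<bar>a n\<bar> \<le> l_inf_norm a"
  using assms unfolding l_inf_def l_inf_norm_def by (auto intro: cSUP_upper)

lemma one_in_l_inf: "(\<lambda>_. 1) \<in> l_inf"
  by (auto simp: l_inf_def)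

lemma H_op_measurable: "H_op lam \<alpha> \<beta> a \<in> borel_measurable (lebesgue_on {0<..})"
  unfolding H_op_def[abs_def] H_term_def
  by (intro measurable_restrict_space1 measurable_completion) measurable

text \<open>
  Writing \<open>m\<^sup>\<alpha> = m\<^bsup>-1-\<epsilon>\<^esup> m\<^bsup>\<alpha>+1+\<epsilon>\<^esup>\<close>, the nonnegative exponent \<open>\<alpha> + 1 + \<epsilon>\<close> allows the second factor
  to be absorbed into the power of \<open>max(m, x)\<close>; the resulting exponent \<open>\<alpha> + 1 + \<epsilon> - \<lambda>\<close> is nonpositive,
  so that \<open>max(m, x)\<close> may be lowered to \<open>max(1, x)\<close>. This treats \<open>m \<le> x\<close> and \<open>m > x\<close>
  at once, and the dependence on \<open>m\<close> that is left is summable.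
\<close>

lemma abs_H_term_le:
  assumes "0 < x" "1 \<le> m" "0 \<le> \<alpha> + 1 + \<epsilon>" "\<alpha> + 1 + \<epsilon> \<le> lam" "\<bar>a m\<bar> \<le> K"
  shows "\<bar>H_term lam \<alpha> \<beta> a x m\<bar>
    \<le> K * two_regime_power \<beta> (\<alpha> + 1 + \<epsilon> - lam) x * real m powr (-1 - \<epsilon>)"
proof -
  let ?M = "max (real m) x"
  have "real m powr \<alpha> = real m powr (-1 - \<epsilon>) * real m powr (\<alpha> + 1 + \<epsilon>)"
    by (simp flip: powr_add)
  also have "\<dots> \<le> real m powr (-1 - \<epsilon>) * ?M powr (\<alpha> + 1 + \<epsilon>)"
    using assms by (intro mult_left_mono powr_mono2) auto
  finally have "real m powr \<alpha> / ?M powr lam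
      \<le> real m powr (-1 - \<epsilon>) * ?M powr (\<alpha> + 1 + \<epsilon>) / ?M powr lam"
    by (rule divide_right_mono) simp
  also have "\<dots> = real m powr (-1 - \<epsilon>) * ?M powr (\<alpha> + 1 + \<epsilon> - lam)"
    by (simp add: powr_diff)
  also have "\<dots> \<le> real m powr (-1 - \<epsilon>) * max 1 x powr (\<alpha> + 1 + \<epsilon> - lam)"
    using assms by (intro mult_left_mono powr_mono2') auto
  finally have "real m powr \<alpha> / ?M powr lam * (x powr \<beta> * \<bar>a m\<bar>)
      \<le> real m powr (-1 - \<epsilon>) * max 1 x powr (\<alpha> + 1 + \<epsilon> - lam) * (x powr \<beta> * K)"
    using assms by (intro mult_mono) auto
  then show ?thesis
    by (simp add: H_term_def two_regime_power_def abs_mult mult_ac)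
qed

lemma H_op_upper_bound:
  assumes \<epsilon>: "0 < \<epsilon>" and x: "0 < x" and exps: "0 \<le> \<alpha> + 1 + \<epsilon>" "\<alpha> + 1 + \<epsilon> \<le> lam"
    and a: "a \<in> l_inf"
  shows "summable (\<lambda>n. H_term lam \<alpha> \<beta> a x (Suc n))"
    and "\<bar>H_op lam \<alpha> \<beta> a x\<bar> \<le> l_inf_norm a * (\<Sum>n. real (Suc n) powr (-1 - \<epsilon>))
           * two_regime_power \<beta> (\<alpha> + 1 + \<epsilon> - lam) x"
proof -
  let ?c = "l_inf_norm a * two_regime_power \<beta> (\<alpha> + 1 + \<epsilon> - lam) x"
  have zeta: "summable (\<lambda>n. real (Suc n) powr (-1 - \<epsilon>))"
    using \<epsilon> summable_real_powr_iff[of "-1 - \<epsilon>"]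
    by (subst summable_Suc_iff[of "\<lambda>n. real n powr (-1 - \<epsilon>)"]) simp
  have bound: "norm (H_term lam \<alpha> \<beta> a x (Suc n)) \<le> ?c * real (Suc n) powr (-1 - \<epsilon>)" for n
    using abs_H_term_le[OF x _ exps abs_le_l_inf_norm[OF a], where m = "Suc n" and \<beta> = \<beta>]
    by simp
  have sum: "summable (\<lambda>n. norm (H_term lam \<alpha> \<beta> a x (Suc n)))"
    by (rule summable_comparison_test'[OF summable_mult[OF zeta, of ?c], of 0])
       (use bound in auto)
  then show "summable (\<lambda>n. H_term lam \<alpha> \<beta> a x (Suc n))"
    by (rule summable_norm_cancel)
  have "\<bar>H_op lam \<alpha> \<beta> a x\<bar> \<le> (\<Sum>n. norm (H_term lam \<alpha> \<beta> a x (Suc n)))"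
    unfolding H_op_def using summable_norm[OF sum] by simp
  also have "\<dots> \<le> (\<Sum>n. ?c * real (Suc n) powr (-1 - \<epsilon>))"
    by (rule suminf_le[OF bound sum summable_mult[OF zeta]])
  also have "\<dots> = ?c * (\<Sum>n. real (Suc n) powr (-1 - \<epsilon>))"
    by (rule suminf_mult[OF zeta])
  finally show "\<bar>H_op lam \<alpha> \<beta> a x\<bar> \<le> l_inf_norm a * (\<Sum>n. real (Suc n) powr (-1 - \<epsilon>))
      * two_regime_power \<beta> (\<alpha> + 1 + \<epsilon> - lam) x"
    by (simp only: mult_ac)
qed

text \<open>
  The constant \<open>min 1 (4\<^sup>r)\<close> covers increasing and decreasing powers together: the smallest value
  on \<open>{y..4 * y}\<close> is taken at \<open>y\<close> in the first case and at \<open>4 * y\<close> in the second.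
\<close>

lemma powr_ge_within_factor_four:
  fixes y m r :: real
  assumes "0 < y" "y \<le> m" "m \<le> 4 * y"
  shows "min 1 (4 powr r) * y powr r \<le> m powr r"
proof (cases "0 \<le> r")
  case True
  then have "y powr r \<le> m powr r"
    using assms by (intro powr_mono2) auto
  moreover have "min 1 (4 powr r) * y powr r \<le> 1 * y powr r"
    by (intro mult_right_mono) auto
  ultimately show ?thesis
    by simp
next
  case False
  have "min 1 (4 powr r) * y powr r \<le> 4 powr r * y powr r"
    by (intro mult_right_mono) auto
  also have "\<dots> = (4 * y) powr r"
    using assms by (simp add: powr_mult)
  also have "\<dots> \<le> m powr r"
    using False assms by (intro powr_mono2') auto
  finally show ?thesis .
qed

text \<open>
  With \<open>y = max(1, x)\<close> and \<open>n = \<lceil>y\<rceil>\<close>, the \<open>n \<ge> y\<close> terms with index in \<open>{n<..2 * n}\<close> suffice: all of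
  these indices lie in \<open>{y..4 * y}\<close>, and they exceed \<open>x\<close>, so the maximum in the kernel is the index.
  Convergence of the series is used to bound it below by its partial sums.
\<close>

lemma H_op_one_lower_bound:
  assumes x: "0 < x" and sum: "summable (\<lambda>n. H_term lam \<alpha> \<beta> (\<lambda>_. 1) x (Suc n))"
  shows "min 1 (4 powr (\<alpha> - lam)) * two_regime_power \<beta> (\<alpha> + 1 - lam) x
    \<le> H_op lam \<alpha> \<beta> (\<lambda>_. 1) x"
proof -
  define y where "y = max 1 x"
  define n where "n = nat \<lceil>y\<rceil>"
  define c where "c = min 1 (4 powr (\<alpha> - lam))"
  have y: "1 \<le> y" "x \<le> y" and c: "0 \<le> c"
    by (auto simp: y_def c_def)
  have n: "y \<le> real n" "real n \<le> 2 * y"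
    using y unfolding n_def by linarith+
  let ?t = "\<lambda>k. H_term lam \<alpha> \<beta> (\<lambda>_. 1) x (Suc k)"
  have block: "c * y powr (\<alpha> - lam) * x powr \<beta> \<le> ?t k" if "k \<in> {n..<2*n}" for k
  proof -
    have "n \<le> k" "Suc k \<le> 2 * n" using that by auto
    then have "real n \<le> real k" "real (Suc k) \<le> 2 * real n"
      by linarith+
    then have k: "y \<le> real (Suc k)" "real (Suc k) \<le> 4 * y"
      using n by linarith+
    then have "c * y powr (\<alpha> - lam) \<le> real (Suc k) powr (\<alpha> - lam)"
      unfolding c_def using y by (intro powr_ge_within_factor_four) auto
    moreover have "max (real (Suc k)) x = real (Suc k)"
      using k y by simp
    then have "?t k = real (Suc k) powr (\<alpha> - lam) * x powr \<beta>"
      by (simp add: H_term_def powr_diff)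
    ultimately show ?thesis
      by (simp add: mult_right_mono)
  qed
  have "y powr (\<alpha> + 1 - lam) = y * y powr (\<alpha> - lam)"
    using y powr_add[of y 1 "\<alpha> - lam"] by (simp add: algebra_simps)
  then have "c * two_regime_power \<beta> (\<alpha> + 1 - lam) x = y * (c * y powr (\<alpha> - lam) * x powr \<beta>)"
    by (simp add: two_regime_power_def y_def)
  also have "\<dots> \<le> real n * (c * y powr (\<alpha> - lam) * x powr \<beta>)"
    using n c by (intro mult_right_mono) auto
  also have "\<dots> = (\<Sum>k\<in>{n..<2*n}. c * y powr (\<alpha> - lam) * x powr \<beta>)"
    by simp
  also have "\<dots> \<le> (\<Sum>k\<in>{n..<2*n}. ?t k)"
    by (rule sum_mono) (rule block)
  also have "\<dots> \<le> (\<Sum>k. ?t k)"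
    by (rule sum_le_suminf[OF sum]) (auto simp: H_term_def)
  finally show ?thesis
    by (simp add: H_op_def c_def)
qed

section \<open>The boundedness criterion\<close>

theorem theorem1p9:
  fixes q lam \<alpha> \<beta> \<psi> :: real
  assumes "1 \<le> q" and "\<alpha> + 1 \<ge> 0"
  shows "H_bounded lam \<alpha> \<beta> l_inf l_inf_norm (weighted_L q \<psi>) (weighted_L_norm q \<psi>) \<longleftrightarrow>
         lam > \<alpha> + \<beta> + 1 + (\<psi> + 1) / q \<and> - q * \<beta> < \<psi> + 1"
proof
  assume bounded: "H_bounded lam \<alpha> \<beta> l_inf l_inf_norm (weighted_L q \<psi>) (weighted_L_norm q \<psi>)"
  define c where "c = min 1 (4 powr (\<alpha> - lam))"
  have c: "0 < c" by (simp add: c_def)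
  have "AE x in lebesgue_on {0<..}. summable (\<lambda>n. H_term lam \<alpha> \<beta> (\<lambda>_. 1) x (Suc n))"
    using bounded one_in_l_inf by (auto simp: H_bounded_def)
  then have lower: "AE x in lebesgue_on {0<..}.
      \<bar>two_regime_power \<beta> (\<alpha> + 1 - lam) x\<bar> \<le> 1 / c * \<bar>H_op lam \<alpha> \<beta> (\<lambda>_. 1) x\<bar>"
    using AE_space
  proof eventually_elim
    case (elim x)
    then have "c * two_regime_power \<beta> (\<alpha> + 1 - lam) x \<le> \<bar>H_op lam \<alpha> \<beta> (\<lambda>_. 1) x\<bar>"
      using H_op_one_lower_bound[of x lam \<alpha> \<beta>] by (simp add: c_def)
    then show ?case
      using c by (simp add: two_regime_power_nonneg field_simps)
  qed
  have H_one: "H_op lam \<alpha> \<beta> (\<lambda>_. 1) \<in> weighted_L q \<psi>"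
    using bounded one_in_l_inf by (auto simp: H_bounded_def)
  have "two_regime_power \<beta> (\<alpha> + 1 - lam) \<in> weighted_L q \<psi>"
    by (rule weighted_L_dominated(1)[OF _ _ two_regime_power_measurable H_one lower])
      (use c assms(1) in auto)
  then have "-1 < q * \<beta> + \<psi>" "q * (\<beta> + (\<alpha> + 1 - lam)) + \<psi> < -1"
    by (simp_all add: two_regime_power_in_weighted_L_iff)
  then show "lam > \<alpha> + \<beta> + 1 + (\<psi> + 1) / q \<and> - q * \<beta> < \<psi> + 1"
    using assms(1) by (simp add: field_simps)
next
  assume conds: "lam > \<alpha> + \<beta> + 1 + (\<psi> + 1) / q \<and> - q * \<beta> < \<psi> + 1"
  \<comment> \<open>Half of the gap in the first inequality keeps the inequality strict after adding \<open>\<epsilon>\<close>.\<close>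
  define \<epsilon> where "\<epsilon> = (lam - (\<alpha> + \<beta> + 1 + (\<psi> + 1) / q)) / 2"
  have \<epsilon>: "0 < \<epsilon>" "\<alpha> + \<beta> + 1 + \<epsilon> + (\<psi> + 1) / q < lam"
    using conds unfolding \<epsilon>_def by argo+
  \<comment> \<open>The second inequality makes the first one strong enough to imply \<open>\<lambda> > \<alpha> + 1 + \<epsilon>\<close>, which
    gives convergence of the series.\<close>
  have "0 < \<beta> + (\<psi> + 1) / q"
    using conds assms(1) by (simp add: field_simps)
  then have exps: "0 \<le> \<alpha> + 1 + \<epsilon>" "\<alpha> + 1 + \<epsilon> \<le> lam"
    using \<epsilon> assms(2) by linarith+
  define g where "g = two_regime_power \<beta> (\<alpha> + 1 + \<epsilon> - lam)"
  define Z where "Z = (\<Sum>n. real (Suc n) powr (-1 - \<epsilon>))"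
  have g: "g \<in> weighted_L q \<psi>"
    unfolding g_def two_regime_power_in_weighted_L_iff
    using conds \<epsilon>(2) assms(1) by (simp add: field_simps)
  have "0 \<le> Z"
    unfolding Z_def by (rule suminf_nonneg)
      (use \<epsilon> summable_real_powr_iff[of "-1 - \<epsilon>"] summable_Suc_iff[of "\<lambda>n. real n powr (-1 - \<epsilon>)"]
        in auto)
  have image: "H_op lam \<alpha> \<beta> a \<in> weighted_L q \<psi> \<and>
      weighted_L_norm q \<psi> (H_op lam \<alpha> \<beta> a) \<le> (Z * weighted_L_norm q \<psi> g) * l_inf_norm a"
    if a: "a \<in> l_inf" for a
  proof -
    have K: "0 \<le> l_inf_norm a * Z"
      using abs_le_l_inf_norm[OF a, of 1] \<open>0 \<le> Z\<close> by (intro mult_nonneg_nonneg) auto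
    have "AE x in lebesgue_on {0<..}. \<bar>H_op lam \<alpha> \<beta> a x\<bar> \<le> (l_inf_norm a * Z) * \<bar>g x\<bar>"
      using H_op_upper_bound(2)[OF \<epsilon>(1) _ exps a, of _ \<beta>]
      by (intro AE_I2) (simp add: g_def Z_def two_regime_power_nonneg)
    note dominated = weighted_L_dominated[OF _ K H_op_measurable g this]
    show ?thesis
      using dominated assms(1) by (simp add: mult_ac)
  qed
  moreover have "AE x in lebesgue_on {0<..}. summable (\<lambda>n. H_term lam \<alpha> \<beta> a x (Suc n))"
    if "a \<in> l_inf" for a
    using H_op_upper_bound(1)[OF \<epsilon>(1) _ exps that] by (intro AE_I2) simp
  ultimately show "H_bounded lam \<alpha> \<beta> l_inf l_inf_norm (weighted_L q \<psi>) (weighted_L_norm q \<psi>)"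
    unfolding H_bounded_def by blast
qed

end
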